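(* Let $x>0$. For $r,t\in\mathbb{N}\cup\{0\}$ such that $r+t\ge 1$, and $s\in\mathbb{C}$ such that $\Re(s)>2-r-t$, we have $$\Theta(r,s,t,x)=\sum_{i=0}^{r-2}\frac{(-1)^i}{x^{t+i}}\binom{i+t-1}{i}\zeta(s+t+i)\zeta(r-i)-\frac{(-1)^r}{x^{r+t-1}}\binom{r+t-2}{t-1}\sum_{m=1}^{\infty}\frac{\gamma+\psi(mx+1)}{m^{r+s+t-1}}$$ $$\qquad+(-1)^r\sum_{j=0}^{t-2}\binom{j+r-1}{j}\frac{(-1)^{t-j}}{(t-j-1)!}\frac{1}{x^{j+r}}\sum_{m=1}^{\infty}\frac{\psi^{(t-j-1)}(mx+1)}{m^{r+s+j}},$$ with the convention that $\binom{-1}{0}=1$, $\binom{c}{-1}=0$ for any $c\in\mathbb{Z}\setminus\{-1\}$, with the exception $\binom{-1}{-1}=1$.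
   Context: $\mathbb{N}=\{1,2,3,\dots\}$. For $x>0$ and $(r,s,t)\in\mathbb{C}^3$ with $\Re(r+t)>1$, $\Re(s+t)>1$, $\Re(r+s+t)>2$, the generalized Mordell–Tornheim zeta function is the absolutely convergent series $\Theta(r,s,t,x)=\sum_{n=1}^{\infty}\sum_{m=1}^{\infty}\frac{1}{n^r m^s (n+mx)^t}$. For fixed $x>0$ it continues meromorphically to $(r,s,t)\in\mathbb{C}^3$, with possible singularities only on the hyperplanes $r+t=1-\ell$, $s+t=1-\ell$ ($\ell\in\mathbb{N}\cup\{0\}$) and $r+s+t=2$; $\Theta$ also denotes this continuation. $\zeta$ is the Riemann zeta function, $\gamma$ is Euler's constant, $\psi=\Gamma'/\Gamma$ is the digamma function and $\psi^{(k)}$ its $k$-th derivative. Empty sums (upper limit smaller than lower limit) are $0$; for integers $0\le a<b$, $\binom{a}{b}=0$.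
   Formalization: The formal theorem assumes (r,s,t) lies on no singular hyperplane of Θ; this excludes r+t=1, where Θ has a pole with residue ζ(s)≠0, and s+t=1-l with 0≤l≤r-2, where the formula contains ζ(1) and Θ has no value. *)

theory Defs
  imports "HOL-Complex_Analysis.Complex_Analysis"
begin

type_synonym complex3 = "complex \<times> complex \<times> complex"

definition holomorphic3_on :: "(complex3 \<Rightarrow> complex) \<Rightarrow> complex3 set \<Rightarrow> bool" where
  "holomorphic3_on f S \<longleftrightarrow>
     (\<forall>p\<in>S. \<exists>a b c. (f has_derivative (\<lambda>(u, v, w). a * u + b * v + c * w)) (at p within S))"

text \<open>A meromorphic function on \<open>\<complex>\<^sup>3\<close> is locally a quotient of holomorphic functions. As it has no
  values at its poles and points of indeterminacy, it is represented by a total function whose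
  values on the exceptional set \<open>E\<close> are disregarded. Balls are connected, so a holomorphic
  denominator with a nonzero value on a ball has a nowhere dense zero set there.\<close>

definition meromorphic3_off :: "(complex3 \<Rightarrow> complex) \<Rightarrow> complex3 set \<Rightarrow> bool" where
  "meromorphic3_off F E \<longleftrightarrow>
     holomorphic3_on F (- E) \<and>
     (\<forall>p. \<exists>e>0. \<exists>g h.
        holomorphic3_on g (ball p e) \<and> holomorphic3_on h (ball p e) \<and>
        (\<exists>q\<in>ball p e. h q \<noteq> 0) \<and>
        (\<forall>q\<in>ball p e - E. h q * F q = g q))"

definition theta_series :: "complex \<Rightarrow> complex \<Rightarrow> complex \<Rightarrow> real \<Rightarrow> complex" where
  "theta_series r s t x =
     (\<Sum>n. \<Sum>m. 1 / (of_nat (Suc n) powr r * of_nat (Suc m) powr s *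
                  of_real (real (Suc n) + real (Suc m) * x) powr t))"

definition theta_convergence :: "complex3 set" where
  "theta_convergence = {(r, s, t). Re (r + t) > 1 \<and> Re (s + t) > 1 \<and> Re (r + s + t) > 2}"

definition theta_singular :: "complex3 set" where
  "theta_singular =
     {(r, s, t). (\<exists>l::nat. r + t = 1 - of_nat l) \<or> (\<exists>l::nat. s + t = 1 - of_nat l) \<or> r + s + t = 2}"

text \<open>The complement of \<open>theta_singular\<close> is connected and contains the nonempty open set
  \<open>theta_convergence\<close>, so the following predicate determines \<open>\<Theta>\<close> uniquely off the
  singular hyperplanes. It says nothing about the values of \<open>\<Theta>\<close> on them.\<close>

definition is_theta_continuation ::
    "real \<Rightarrow> (complex \<Rightarrow> complex \<Rightarrow> complex \<Rightarrow> complex) \<Rightarrow> bool" where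
  "is_theta_continuation x \<Theta> \<longleftrightarrow>
     meromorphic3_off (\<lambda>(r, s, t). \<Theta> r s t) theta_singular \<and>
     (\<forall>(r, s, t)\<in>theta_convergence. \<Theta> r s t = theta_series r s t x)"

text \<open>The value at the pole \<open>1\<close> is unspecified; all other values are determined by the identity
  theorem.\<close>

definition riemann_zeta :: "complex \<Rightarrow> complex" where
  "riemann_zeta =
     (SOME f. f holomorphic_on - {1} \<and>
        (\<forall>s. Re s > 1 \<longrightarrow> f s = (\<Sum>n. 1 / of_nat (Suc n) powr s)))"

text \<open>Integer binomial coefficients with the conventions \<open>binom (-1) 0 = binom (-1) (-1) = 1\<close> and
  \<open>binom c (-1) = 0\<close> for \<open>c \<noteq> -1\<close>. Arguments outside \<open>a \<ge> -1\<close>, \<open>b \<ge> -1\<close>, and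
  \<open>a = -1\<close> with \<open>b > 0\<close>, are never used; the value there is set to \<open>0\<close>.\<close>

definition binom :: "int \<Rightarrow> int \<Rightarrow> nat" where
  "binom a b =
     (if a = -1 \<and> (b = 0 \<or> b = -1) then 1
      else if a < 0 \<or> b < 0 then 0
      else nat a choose nat b)"

end

theory Submission
  imports Defs
begin

text \<open>Off the singular hyperplanes, \<open>r + t \<noteq> 1\<close>, so \<open>r + t \<ge> 2\<close>. For \<open>Re s > 1\<close> the double series may
  then be summed over \<open>n\<close> first, and the partial fraction expansion of
  \<open>1 / (n\<^sup>r (n + mx)\<^sup>t)\<close> in \<open>n\<close> turns the inner sum into zeta values and polygamma values at
  \<open>mx + 1\<close>. For fixed \<open>r\<close> and \<open>t\<close> both sides are holomorphic in \<open>s\<close> on the half plane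
  \<open>Re s > 2 - r - t\<close> with finitely many points removed, which is connected, so the identity
  theorem extends the formula.\<close>

subsection \<open>Dominated series of holomorphic functions\<close>

text \<open>The half plane is the common domain of the series on the right. The inner sum of order k
  is bounded by a multiple of (mx)^(e-k) for every small e > 0, so its Dirichlet series in w
  converges for Re w > 1 - k; k = 0 at w = r + s + t - 1 and k = t - j - 1 at w = r + s + j both
  give Re s > 2 - r - t. The hyperplane r + s + t = 2 is then a boundary point, and the points to be
  removed are the poles of the factors zeta(s + t + i). Two obstacles shape the rest. Summed over n,
  the simple poles of the partial fractions diverge separately; their opposite residues combine them
  into 1/n - 1/(n + mx), the source of gamma + psi. And the zeta factors are also evaluated to the
  left of the line Re = 1, while \<open>riemann_zeta\<close> is a \<open>SOME\<close> choice, so a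
  continuation must be constructed before anything is known about it.\<close>

lemma holomorphic_on_suminf:
  fixes f :: "nat \<Rightarrow> complex \<Rightarrow> complex"
  assumes S: "open S" and f: "\<And>n. f n holomorphic_on S"
    and dom: "\<And>s. s \<in> S \<Longrightarrow>
      \<exists>d>0. \<exists>h. summable h \<and> (\<forall>n. \<forall>y\<in>ball s d \<inter> S. norm (f n y) \<le> h n)"
  shows "(\<lambda>s. \<Sum>n. f n s) holomorphic_on S"
proof -
  have "\<exists>g g'. \<forall>s\<in>S. (\<lambda>n. f n s) sums g s \<and> (\<lambda>n. deriv (f n) s) sums g' s \<and>
      (g has_field_derivative g' s) (at s)"
  proof (rule series_and_derivative_comparison_local[OF S])
    show "(f n has_field_derivative deriv (f n) s) (at s)" if "s \<in> S" for n s
      using holomorphic_derivI[OF f S that] .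
    show "\<exists>d h. 0 < d \<and> summable h \<and> (\<forall>\<^sub>F n in sequentially. \<forall>y\<in>ball s d \<inter> S. norm (f n y) \<le> h n)"
      if s: "s \<in> S" for s
    proof -
      obtain d h where "d > 0" "summable h" "\<forall>n. \<forall>y\<in>ball s d \<inter> S. norm (f n y) \<le> h n"
        using dom[OF s] by blast
      then show ?thesis by (intro exI[of _ d] exI[of _ h]) auto
    qed
  qed
  then obtain g g' where g: "\<And>s. s \<in> S \<Longrightarrow> (\<lambda>n. f n s) sums g s"
    and g': "\<And>s. s \<in> S \<Longrightarrow> (g has_field_derivative g' s) (at s)" by blast
  have "g holomorphic_on S"
    using g' holomorphic_on_open[OF S] by blast
  then show ?thesis
    by (rule holomorphic_transform) (use g sums_unique in blast)
qed

lemma norm_nat_powr: "norm (of_nat (Suc n) powr s :: complex) = real (Suc n) powr Re s"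
  by (subst norm_powr_real_powr) auto

lemma summable_Suc_powr_iff: "summable (\<lambda>n. real (Suc n) powr a) \<longleftrightarrow> a < -1"
  using summable_Suc_iff[of "\<lambda>n. real n powr a"] summable_real_powr_iff[of a] by simp

lemma open_Re_greater: "open {s. Re s > a}"
  by (simp add: open_halfspace_Re_gt)

lemma connected_Re_greater: "connected {s. Re s > a}"
  by (simp add: convex_connected convex_halfspace_Re_gt)

lemma holomorphic_on_dirichlet_series:
  assumes "\<And>\<sigma>. \<sigma> > \<sigma>0 \<Longrightarrow> summable (\<lambda>n. norm (c n) * real (Suc n) powr (- \<sigma>))"
  shows "(\<lambda>s. \<Sum>n. c n / of_nat (Suc n) powr s) holomorphic_on {s. Re s > \<sigma>0}"
proof (rule holomorphic_on_suminf[OF open_Re_greater])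
  show "(\<lambda>s. c n / of_nat (Suc n) powr s) holomorphic_on {s. Re s > \<sigma>0}" for n
    by (intro holomorphic_intros) auto
  fix s assume s: "s \<in> {s. Re s > \<sigma>0}"
  \<comment> \<open>Half the distance to the boundary: the whole ball stays to the right of
    \<open>\<sigma>0 + d\<close>, where the series with real exponent converges and serves as
    majorant.\<close>
  define d where "d = (Re s - \<sigma>0) / 2"
  have d: "d > 0" using s by (simp add: d_def)
  have "norm (c n / of_nat (Suc n) powr y) \<le> norm (c n) * real (Suc n) powr (- (\<sigma>0 + d))"
    if y: "y \<in> ball s d" for n y
  proof -
    have "\<bar>Re (s - y)\<bar> < d"
      using y abs_Re_le_cmod[of "s - y"] unfolding mem_ball dist_norm by linarith
    then have "Re y \<ge> \<sigma>0 + d" unfolding d_def by (simp only: minus_complex.sel) argo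
    then have "real (Suc n) powr (- Re y) \<le> real (Suc n) powr (- (\<sigma>0 + d))"
      by (intro powr_mono) auto
    then show ?thesis
      unfolding divide_inverse norm_mult norm_inverse norm_nat_powr powr_minus
      by (rule mult_left_mono) simp
  qed
  moreover have "summable (\<lambda>n. norm (c n) * real (Suc n) powr (- (\<sigma>0 + d)))"
    using d by (intro assms) simp
  ultimately show "\<exists>d>0. \<exists>h. summable h \<and>
      (\<forall>n. \<forall>y\<in>ball s d \<inter> {s. Re s > \<sigma>0}. norm (c n / of_nat (Suc n) powr y) \<le> h n)"
    using d by blast
qed

subsection \<open>Continuation of the zeta function\<close>

definition zeta_sum :: "complex \<Rightarrow> complex" where
  "zeta_sum s = (\<Sum>n. 1 / of_nat (Suc n) powr s)"

lemma zeta_sum_summable: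
  assumes "Re s > 1"
  shows "summable (\<lambda>n. norm (1 / of_nat (Suc n) powr s :: complex))"
proof -
  have "summable (\<lambda>n. real (Suc n) powr (- Re s))"
    unfolding summable_Suc_powr_iff using assms by simp
  then show ?thesis
    by (simp only: norm_divide norm_nat_powr powr_minus_divide norm_one)
qed

lemma zeta_sum_sums: "Re s > 1 \<Longrightarrow> (\<lambda>n. 1 / of_nat (Suc n) powr s) sums zeta_sum s"
  unfolding zeta_sum_def by (intro summable_sums summable_norm_cancel[OF zeta_sum_summable])

lemma holomorphic_zeta_sum: "zeta_sum holomorphic_on {s. Re s > 1}"
  unfolding zeta_sum_def
  by (rule holomorphic_on_dirichlet_series)
     (simp add: summable_Suc_powr_iff del: of_nat_Suc)

text \<open>The coefficient in the k-th derivative of \<open>z powr w\<close>.\<close>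

definition falling :: "complex \<Rightarrow> nat \<Rightarrow> complex" where
  "falling w k = (\<Prod>i<k. w - of_nat i)"

lemma falling_0 [simp]: "falling w 0 = 1"
  and falling_Suc: "falling w (Suc k) = falling w k * (w - of_nat k)"
  by (simp_all add: falling_def)

lemma falling_holomorphic [holomorphic_intros]:
  "f holomorphic_on S \<Longrightarrow> (\<lambda>s. falling (f s) k) holomorphic_on S"
  unfolding falling_def by (intro holomorphic_intros)

text \<open>Taylor expansion of \<open>z powr w\<close> at \<open>Suc n\<close> with step 1. Since
  \<open>Re w\<close> is at most \<open>Suc L\<close>, the modulus of the derivative of order
  \<open>Suc L\<close> does not increase along the segment, so its value at the left end bounds the
  remainder.\<close>

lemma powr_Suc_taylor_bound:
  assumes "Re w \<le> real (Suc L)"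
  shows "norm (of_nat (Suc (Suc n)) powr w -
            (\<Sum>k\<le>L. falling w k / fact k * of_nat (Suc n) powr (w - of_nat k)))
         \<le> norm (falling w (Suc L)) * real (Suc n) powr (Re w - real (Suc L))"
proof -
  define f where "f = (\<lambda>k z. falling w k * z powr (w - of_nat k))"
  define S where "S = closed_segment (of_nat (Suc n)) (of_nat (Suc (Suc n)) :: complex)"
  define B where "B = norm (falling w (Suc L)) * real (Suc n) powr (Re w - real (Suc L))"
  have S: "\<exists>v. z = of_real v \<and> v \<ge> real (Suc n)" if "z \<in> S" for z
  proof -
    from that obtain u where u: "0 \<le> u" "z = (1 - u) *\<^sub>R of_nat (Suc n) + u *\<^sub>R of_nat (Suc (Suc n))"
      unfolding S_def in_segment by blast
    then have "z = of_real (real (Suc n) + u)"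
      by (simp add: scaleR_conv_of_real algebra_simps)
    with u show ?thesis by (intro exI[of _ "real (Suc n) + u"]) auto
  qed
  have B0: "B \<ge> 0" by (simp add: B_def)
  have "norm (f 0 (of_nat (Suc (Suc n))) -
          (\<Sum>k\<le>L. f k (of_nat (Suc n)) * (of_nat (Suc (Suc n)) - of_nat (Suc n)) ^ k / fact k))
      \<le> B * norm (of_nat (Suc (Suc n)) - of_nat (Suc n) :: complex) ^ Suc L / fact L"
  proof (rule complex_Taylor[where S = S])
    show "convex S" by (simp add: S_def)
    show "of_nat (Suc n) \<in> S" "of_nat (Suc (Suc n)) \<in> S" by (simp_all add: S_def)
    show "(f k has_field_derivative f (Suc k) z) (at z within S)" if "z \<in> S" for k z
    proof -
      from S[OF that] obtain v where "z = of_real v" "v \<ge> real (Suc n)" by blast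
      then have z: "z \<notin> \<real>\<^sub>\<le>\<^sub>0" by simp
      have "(f k has_field_derivative falling w k * ((w - of_nat k) * z powr (w - of_nat k - 1))) (at z)"
        unfolding f_def by (rule DERIV_cmult[OF has_field_derivative_powr[OF z]])
      also have "falling w k * ((w - of_nat k) * z powr (w - of_nat k - 1)) = f (Suc k) z"
        by (simp add: f_def falling_Suc diff_diff_eq add.commute)
      finally have "(f k has_field_derivative f (Suc k) z) (at z)" .
      then show ?thesis by (rule has_field_derivative_at_within)
    qed
    show "norm (f (Suc L) z) \<le> B" if "z \<in> S" for z
    proof -
      from S[OF that] obtain v where v: "z = of_real v" "v \<ge> real (Suc n)" by blast
      have "v powr (Re w - real (Suc L)) \<le> real (Suc n) powr (Re w - real (Suc L))"
        using assms v by (intro powr_mono2') auto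
      moreover have "norm (z powr (w - of_nat (Suc L))) = v powr (Re w - real (Suc L))"
        using v by (subst norm_powr_real_powr) auto
      ultimately show ?thesis
        unfolding f_def B_def norm_mult by (simp add: mult_left_mono)
    qed
  qed
  also have "\<dots> = B / fact L" by simp
  also have "\<dots> \<le> B / 1" using B0 by (intro divide_left_mono) auto
  finally show ?thesis by (simp add: f_def B_def)
qed

text \<open>Summing the Taylor expansion of \<open>z\<^bsup>1-s\<^esup>\<close> from \<open>n\<close> to \<open>n + 1\<close> over \<open>n\<close>
  telescopes and expresses \<open>(s - 1) \<zeta>(s)\<close> through \<open>\<zeta>(s + 1), \<dots>, \<zeta>(s + K)\<close>, up to a series
  converging for \<open>Re s > - K\<close>.\<close>

lemma zeta_half_plane_continuation:
  "\<exists>Z. Z holomorphic_on {s. Re s > 1 - real K} \<and>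
       (\<forall>s. Re s > 1 \<longrightarrow> Z s = (s - 1) * zeta_sum s)"
proof (induction K)
  case 0
  show ?case
    by (rule exI[of _ "\<lambda>s. (s - 1) * zeta_sum s"])
       (auto intro!: holomorphic_intros holomorphic_zeta_sum)
next
  case (Suc K)
  then obtain Z where Z: "Z holomorphic_on {s. Re s > 1 - real K}"
    and Z_eq: "\<And>s. Re s > 1 \<Longrightarrow> Z s = (s - 1) * zeta_sum s" by blast
  \<comment> \<open>The remainder of order \<open>L\<close> is of size n^(-Re s - L), hence summable
    exactly on the half plane that is one unit larger than that of \<open>Z\<close>.\<close>
  define L where "L = Suc K"
  define c where "c = (\<lambda>s k. falling (1 - s) k / fact k)"
  define R where "R = (\<lambda>n s. of_nat (Suc (Suc n)) powr (1 - s) -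
      (\<Sum>k\<le>L. c s k * of_nat (Suc n) powr (1 - s - of_nat k)))"
  \<comment> \<open>The telescoped identity solved for \<open>(s - 1) * zeta_sum s\<close>. The last
    factor of \<open>falling (1 - s) (Suc k)\<close> is minus the factor \<open>s + k - 1\<close> in
    \<open>Z (s + k)\<close>, so the poles of the shifted zeta values are already absorbed.\<close>
  define W where "W = (\<lambda>s. 1 + (\<Sum>n. R n s) -
      (\<Sum>k=1..K. falling (1 - s) k / fact (Suc k) * Z (s + of_nat k)))"
  let ?H = "{s. Re s > 1 - real L}"
  have "(\<lambda>s. \<Sum>n. R n s) holomorphic_on ?H"
  proof (rule holomorphic_on_suminf[OF open_Re_greater])
    show "R n holomorphic_on ?H" for n
      unfolding R_def c_def by (intro holomorphic_intros) auto
    fix s assume s: "s \<in> ?H"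
    define d where "d = (Re s - (1 - real L)) / 2"
    have d: "d > 0" using s by (simp add: d_def)
    have "continuous_on (cball s d) (\<lambda>y. falling (1 - y) (Suc L))"
      by (intro holomorphic_on_imp_continuous_on holomorphic_intros)
    then have "bounded ((\<lambda>y. falling (1 - y) (Suc L)) ` cball s d)"
      by (intro compact_imp_bounded compact_continuous_image) auto
    then obtain M where M: "\<And>y. y \<in> cball s d \<Longrightarrow> norm (falling (1 - y) (Suc L)) \<le> M"
      unfolding bounded_iff by blast
    have M0: "M \<ge> 0" using M[of s] d norm_ge_zero[of "falling (1 - s) (Suc L)"] by (simp del: norm_ge_zero)
    have "norm (R n y) \<le> M * real (Suc n) powr (- 1 - d)" if y: "y \<in> ball s d" for n y
    proof -
      have "\<bar>Re (s - y)\<bar> < d"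
        using y abs_Re_le_cmod[of "s - y"] unfolding mem_ball dist_norm by linarith
      then have Rey: "Re y > 1 - real L + d" unfolding d_def by (simp only: minus_complex.sel) argo
      have "norm (R n y) \<le> norm (falling (1 - y) (Suc L)) * real (Suc n) powr (Re (1 - y) - real (Suc L))"
        unfolding R_def c_def using Rey d by (intro powr_Suc_taylor_bound) simp
      also have "\<dots> \<le> M * real (Suc n) powr (- 1 - d)"
        using Rey y M0 by (intro mult_mono powr_mono M) auto
      finally show ?thesis .
    qed
    moreover have "summable (\<lambda>n. M * real (Suc n) powr (- 1 - d))"
      using d by (intro summable_mult) (simp add: summable_Suc_powr_iff del: of_nat_Suc)
    ultimately show "\<exists>d>0. \<exists>h. summable h \<and> (\<forall>n. \<forall>y\<in>ball s d \<inter> ?H. norm (R n y) \<le> h n)"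
      using d by blast
  qed
  moreover have "(\<lambda>s. Z (s + of_nat k)) holomorphic_on ?H" if "k \<in> {1..K}" for k
  proof -
    have "(Z \<circ> (\<lambda>s. s + of_nat k)) holomorphic_on ?H"
      using that by (intro holomorphic_on_compose_gen[OF _ Z] holomorphic_intros) (auto simp: L_def)
    then show ?thesis by (simp add: o_def)
  qed
  ultimately have "W holomorphic_on ?H"
    unfolding W_def by (intro holomorphic_intros) auto
  moreover have "W s = (s - 1) * zeta_sum s" if s: "Re s > 1" for s
  proof -
    have tele: "(\<lambda>n. of_nat (Suc (Suc n)) powr (1 - s) - of_nat (Suc n) powr (1 - s)) sums (0 - of_nat (Suc 0) powr (1 - s))"
      by (intro telescope_sums[of "\<lambda>n. of_nat (Suc n) powr (1 - s)"]
            tendsto_neg_powr_complex_of_nat filterlim_Suc) (use s in simp)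
    have zk: "(\<lambda>n. of_nat (Suc n) powr (1 - s - of_nat k)) sums zeta_sum (s + of_nat k - 1)"
      if "k \<ge> 1" for k
    proof -
      have "of_nat (Suc n) powr (1 - s - of_nat k) = 1 / of_nat (Suc n) powr (s + of_nat k - 1)" for n
        using powr_minus[of "of_nat (Suc n) :: complex" "s + of_nat k - 1"]
        by (simp add: divide_inverse algebra_simps)
      then show ?thesis
        using zeta_sum_sums[of "s + of_nat k - 1"] s that by simp
    qed
    have "(\<lambda>n. (of_nat (Suc (Suc n)) powr (1 - s) - of_nat (Suc n) powr (1 - s)) -
             (\<Sum>k=1..L. c s k * of_nat (Suc n) powr (1 - s - of_nat k)))
          sums ((0 - of_nat (Suc 0) powr (1 - s)) - (\<Sum>k=1..L. c s k * zeta_sum (s + of_nat k - 1)))"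
      by (intro sums_diff[OF tele] sums_sum sums_mult zk) auto
    moreover have "R n s = (of_nat (Suc (Suc n)) powr (1 - s) - of_nat (Suc n) powr (1 - s)) -
             (\<Sum>k=1..L. c s k * of_nat (Suc n) powr (1 - s - of_nat k))" for n
    proof -
      have split: "(\<Sum>k\<le>L. g k) = g 0 + (\<Sum>k=1..L. g k)" for g :: "nat \<Rightarrow> complex"
        by (simp add: atMost_atLeast0 sum.atLeast_Suc_atMost)
      show ?thesis
        unfolding R_def split c_def
        by (simp only: falling_0 fact_0 div_by_1 mult_1 of_nat_0 diff_zero diff_diff_eq)
    qed
    ultimately have R: "(\<Sum>n. R n s) = - 1 - (\<Sum>k=1..L. c s k * zeta_sum (s + of_nat k - 1))"
      by (simp add: sums_iff)
    have "(\<Sum>k=1..L. c s k * zeta_sum (s + of_nat k - 1)) =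
        (\<Sum>k=0..K. c s (Suc k) * zeta_sum (s + of_nat k))"
      using sum.shift_bounds_cl_Suc_ivl[of "\<lambda>k. c s k * zeta_sum (s + of_nat k - 1)" 0 K]
      by (simp add: L_def add.assoc[symmetric])
    also have "\<dots> = (1 - s) * zeta_sum s + (\<Sum>k=1..K. c s (Suc k) * zeta_sum (s + of_nat k))"
      by (subst sum.atLeast_Suc_atMost) (auto simp: c_def falling_Suc)
    also have "(\<Sum>k=1..K. c s (Suc k) * zeta_sum (s + of_nat k)) =
        - (\<Sum>k=1..K. falling (1 - s) k / fact (Suc k) * Z (s + of_nat k))"
      unfolding sum_negf[symmetric]
    proof (rule sum.cong[OF refl])
      fix k assume "k \<in> {1..K}"
      then have "Z (s + of_nat k) = (s + of_nat k - 1) * zeta_sum (s + of_nat k)"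
        using s by (intro Z_eq) auto
      moreover have "c s (Suc k) = - (falling (1 - s) k / fact (Suc k) * (s + of_nat k - 1))"
      proof -
        have *: "1 - s - of_nat k = - (s + of_nat k - 1)" by simp
        show ?thesis
          unfolding c_def falling_Suc *
          by (simp only: mult_minus_right minus_divide_left times_divide_eq_left)
      qed
      ultimately show "c s (Suc k) * zeta_sum (s + of_nat k) =
          - (falling (1 - s) k / fact (Suc k) * Z (s + of_nat k))"
        by (simp only: mult.assoc mult_minus_left)
    qed
    finally show ?thesis
      unfolding W_def R by (simp add: algebra_simps)
  qed
  ultimately show ?case unfolding L_def by blast
qed

text \<open>By the identity theorem the continuations to nested half planes agree, so they glue to
  an entire function; dividing by \<open>s - 1\<close> leaves at most the pole at 1.\<close>

lemma zeta_continuation: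
  "\<exists>f. f holomorphic_on - {1} \<and> (\<forall>s. Re s > 1 \<longrightarrow> f s = zeta_sum s)"
proof -
  obtain Z where Z: "\<And>K. Z K holomorphic_on {s. Re s > 1 - real K}"
    and Z_eq: "\<And>K s. Re s > 1 \<Longrightarrow> Z K s = (s - 1) * zeta_sum s"
    using zeta_half_plane_continuation by metis
  have mono: "Z K s = Z K' s" if "K \<le> K'" "Re s > 1 - real K" for K K' s
  proof (rule analytic_continuation_open[of "{s. Re s > 1}" "{s. Re s > 1 - real K}" "Z K" "Z K'"])
    show "{s. Re s > 1} \<noteq> {}" by (auto intro!: exI[of _ 2])
    show "Z K' holomorphic_on {s. Re s > 1 - real K}"
      using that by (intro holomorphic_on_subset[OF Z]) auto
  qed (use that Z Z_eq open_Re_greater connected_Re_greater in auto)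
  have agree: "Z K s = Z K' s" if "Re s > 1 - real K" "Re s > 1 - real K'" for K K' s
    using mono[of K K' s] mono[of K' K s] that by (metis nat_le_linear)
  \<comment> \<open>Any index \<open>K\<close> with \<open>Re s > 1 - real K\<close> would do; this
    ceiling satisfies it with room to spare.\<close>
  define F where "F = (\<lambda>s. Z (nat \<lceil>2 - Re s\<rceil>) s)"
  have F: "F s = Z K s" if "Re s > 1 - real K" for s K
    unfolding F_def using that by (intro agree) linarith+
  have "F holomorphic_on (\<Union>K. {s. Re s > 1 - real K})"
    by (intro holomorphic_on_UN_open open_Re_greater holomorphic_transform[OF Z]) (simp add: F)
  moreover have "(\<Union>K. {s. Re s > 1 - real K}) = UNIV"
  proof -
    have "\<exists>K. Re s > 1 - real K" for s
      using reals_Archimedean2[of "1 - Re s"] by (auto simp: algebra_simps)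
    then show ?thesis by auto
  qed
  ultimately have F_hol: "F holomorphic_on UNIV" by simp
  show ?thesis
  proof (intro exI[of _ "\<lambda>s. F s / (s - 1)"] conjI allI impI)
    show "(\<lambda>s. F s / (s - 1)) holomorphic_on - {1}"
      by (intro holomorphic_intros holomorphic_on_subset[OF F_hol]) auto
    show "F s / (s - 1) = zeta_sum s" if "Re s > 1" for s
      using F[of 0 s] Z_eq[of s 0] that by auto
  qed
qed

lemma holomorphic_riemann_zeta: "riemann_zeta holomorphic_on - {1}"
  and riemann_zeta_eq_sum: "Re s > 1 \<Longrightarrow> riemann_zeta s = zeta_sum s"
  using someI_ex[OF zeta_continuation[unfolded zeta_sum_def]]
  unfolding riemann_zeta_def zeta_sum_def by blast+

text \<open>For the exchange of the two summations in the theta series. A product majorant makes the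
  family absolutely summable over pairs, so Fubini holds for unordered sums, and these coincide with
  the ordered ones.\<close>

lemma suminf_swap_dominated:
  fixes f :: "nat \<Rightarrow> nat \<Rightarrow> complex"
  assumes g: "summable g" and h: "summable h"
    and le: "\<And>m n. norm (f m n) \<le> g m * h n"
    and nonneg: "\<And>m. g m \<ge> 0" "\<And>n. h n \<ge> 0"
  shows "(\<Sum>m. \<Sum>n. f m n) = (\<Sum>n. \<Sum>m. f m n)"
proof -
  have g': "g summable_on UNIV" and h': "h summable_on UNIV"
    using g h nonneg by (auto simp: summable_on_UNIV_nonneg_real_iff)
  have "(\<lambda>p. norm (case p of (m, n) \<Rightarrow> g m * h n)) summable_on UNIV \<times> UNIV"
    unfolding Infinite_Sum.abs_summable_on_Sigma_iff
    using g' h' nonneg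
    by (auto simp: abs_mult infsum_cmult_right' intro!: summable_on_cmult_right summable_on_cmult_left infsum_nonneg)
  then have gh: "(\<lambda>(m, n). g m * h n) summable_on UNIV \<times> UNIV"
    using abs_summable_summable by blast
  have "(\<lambda>p. norm (case p of (m, n) \<Rightarrow> f m n)) summable_on UNIV \<times> UNIV"
    by (rule Infinite_Sum.abs_summable_on_comparison_test'[OF gh]) (use le in auto)
  then have f: "(\<lambda>(m, n). f m n) summable_on UNIV \<times> UNIV"
    using abs_summable_summable by blast
  have infsum: "infsum u UNIV = suminf u" if "u summable_on UNIV" for u :: "nat \<Rightarrow> complex"
    using has_sum_imp_sums[OF has_sum_infsum[OF that]] by (simp add: sums_unique)
  have f': "(\<lambda>(n, m). f m n) summable_on UNIV \<times> UNIV"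
    using f by (subst summable_on_swap) simp
  have row: "f m summable_on UNIV" for m
    using summable_on_SigmaD1[OF f, of m] by simp
  have col: "(\<lambda>m. f m n) summable_on UNIV" for n
    using summable_on_SigmaD1[OF f', of n] by simp
  have "(\<lambda>m. infsum (f m) UNIV) summable_on UNIV" "(\<lambda>n. infsum (\<lambda>m. f m n) UNIV) summable_on UNIV"
    using summable_on_Sigma_banach[OF f] summable_on_Sigma_banach[OF f'] by simp_all
  with infsum_swap_banach[OF f] show ?thesis
    by (simp add: infsum row col)
qed

subsection \<open>Partial fractions\<close>

text \<open>The principal part at \<open>z = 0\<close> of \<open>1 / (z ^ p * (a - z) ^ q)\<close>,
  read off from the binomial series of the second factor. For \<open>q = 0\<close> truncated
  subtraction makes the coefficient 1 at \<open>j = 0\<close> and 0 elsewhere, as required.\<close>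

definition pole_part :: "'a::field_char_0 \<Rightarrow> 'a \<Rightarrow> nat \<Rightarrow> nat \<Rightarrow> 'a" where
  "pole_part a z p q = (\<Sum>j<p. of_nat ((j + q - 1) choose j) / (a ^ (j + q) * z ^ (p - j)))"

lemma pole_part_0_left [simp]: "pole_part a z 0 q = 0"
  by (simp add: pole_part_def)

lemma pole_part_0_right:
  assumes "p > 0"
  shows "pole_part a z p 0 = 1 / z ^ p"
proof -
  obtain p' where p: "p = Suc p'" using assms by (cases p) auto
  show ?thesis unfolding pole_part_def p sum.lessThan_Suc_shift by (simp add: binomial_eq_0)
qed

text \<open>Multiplying \<open>1 / (z ^ Suc p * (a - z) ^ Suc q)\<close> by a = z + (a - z) splits
  it into two terms with one exponent lowered; on coefficients this is Pascal's rule.\<close>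

lemma pole_part_Suc_Suc:
  assumes "a \<noteq> 0"
  shows "pole_part a z (Suc p) (Suc q) = (pole_part a z p (Suc q) + pole_part a z (Suc p) q) / a"
proof -
  have "of_nat ((Suc j + Suc q - 1) choose Suc j) / (a ^ (Suc j + Suc q) * z ^ (Suc p - Suc j)) =
      (of_nat ((j + Suc q - 1) choose j) / (a ^ (j + Suc q) * z ^ (p - j)) +
       of_nat ((Suc j + q - 1) choose Suc j) / (a ^ (Suc j + q) * z ^ (Suc p - Suc j))) / a" for j
    by (simp add: add_divide_distrib[symmetric] mult_ac)
  then show ?thesis
    unfolding pole_part_def sum.lessThan_Suc_shift
    by (simp add: add_divide_distrib sum_divide_distrib sum.distrib mult_ac del: binomial_Suc_Suc power_Suc)
       (simp add: mult_ac)
qed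

text \<open>Both sides obey the same recursion: B - A times the left side is a difference of two
  terms with one exponent lowered, and \<open>pole_part_Suc_Suc\<close> matches this. The induction
  stops when an exponent is 0.\<close>

lemma partial_fractions:
  fixes A B :: "'a::field_char_0"
  assumes "A \<noteq> 0" "B \<noteq> 0" "A \<noteq> B" "p + q > 0"
  shows "1 / (A ^ p * B ^ q) =
    (-1) ^ q * pole_part (A - B) A p q + (-1) ^ p * pole_part (B - A) B q p"
  using assms(4)
proof (induction "p + q" arbitrary: p q rule: less_induct)
  case less
  show ?case
  proof (cases "p = 0 \<or> q = 0")
    case True
    then show ?thesis using less.prems by (auto simp: pole_part_0_right)
  next
    case False
    then obtain p' q' where pq: "p = Suc p'" "q = Suc q'" by (metis not0_implies_Suc)
    have ne: "A - B \<noteq> 0" "B - A \<noteq> 0" using assms by auto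
    have "1 / (A ^ p * B ^ q) = (1 / (A ^ p * B ^ q') - 1 / (A ^ p' * B ^ q)) / (B - A)"
      using assms ne by (simp add: pq divide_simps)
    also have "1 / (A ^ p * B ^ q') =
        (-1) ^ q' * pole_part (A - B) A p q' + (-1) ^ p * pole_part (B - A) B q' p"
      by (rule less.hyps) (auto simp: pq)
    also have "1 / (A ^ p' * B ^ q) =
        (-1) ^ q * pole_part (A - B) A p' q + (-1) ^ p' * pole_part (B - A) B q p'"
      by (rule less.hyps) (auto simp: pq)
    finally have "1 / (A ^ p * B ^ q) =
        ((-1) ^ q' * pole_part (A - B) A p q' + (-1) ^ p * pole_part (B - A) B q' p -
         ((-1) ^ q * pole_part (A - B) A p' q + (-1) ^ p' * pole_part (B - A) B q p')) / (B - A)" .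
    moreover have "pole_part (A - B) A (Suc p') (Suc q') =
        (pole_part (A - B) A p' (Suc q') + pole_part (A - B) A (Suc p') q') / - (B - A)"
      using pole_part_Suc_Suc[OF ne(1), of A p' q'] by simp
    moreover note pole_part_Suc_Suc[OF ne(2), of B q' p']
    \<comment> \<open>The bookkeeping of signs, applied with \<open>e = (-1) ^ q'\<close>,
      \<open>f = (-1) ^ p'\<close> and \<open>d = B - A\<close>.\<close>
    moreover have "(e * u + - f * v - (- e * w + f * y)) / d = - e * ((w + u) / - d) + - f * ((v + y) / d)"
      for d e f u v w y :: 'a
      by (simp add: add_divide_distrib diff_divide_distrib distrib_left right_diff_distrib)
    ultimately show ?thesis
      by (simp only: pq power_Suc[of "-1"] mult_minus1)
  qed
qed

text \<open>At \<open>i = q = 0\<close> the upper argument is -1, and the convention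
  \<open>binom (-1) 0 = 1\<close> agrees with truncated subtraction.\<close>

lemma binom_diag: "binom (int i + int q - 1) (int i) = (i + q - 1) choose i"
proof (cases "i + q = 0")
  case False
  then have "int i + int q - 1 = int (i + q - 1)" by linarith
  moreover have "binom (int n) (int i) = n choose i" for n by (simp add: binom_def)
  ultimately show ?thesis by (simp only:)
qed (simp add: binom_def)

text \<open>Splits off the simple pole \<open>j = p - 1\<close>, whose series over n diverges by
  itself. If \<open>p = 0\<close> or \<open>q = 0\<close>, there is no such contribution, and the
  bound on \<open>p + q\<close> makes its binomial coefficient vanish.\<close>

lemma pole_part_split:
  fixes a z :: "'a::field_char_0"
  assumes "p + q \<ge> 2"
  shows "pole_part a z p q =
    (\<Sum>j<p - 1. of_nat (binom (int j + int q - 1) (int j)) / (a ^ (j + q) * z ^ (p - j))) +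
    of_nat (binom (int p + int q - 2) (int q - 1)) / (a ^ (p + q - 1) * z)"
proof (cases p)
  case 0
  then have "nat (int q - 2) < nat (int q - 1)" using assms by linarith
  with 0 show ?thesis using assms by (simp add: binom_def binomial_eq_0)
next
  case (Suc p')
  have "binom (int p + int q - 2) (int q - 1) = (p' + q - 1) choose p'"
  proof (cases "q = 0")
    case True
    then show ?thesis using Suc assms by (simp add: binom_def binomial_eq_0)
  next
    case False
    then obtain q' where "q = Suc q'" by (cases q) auto
    then show ?thesis
      using binomial_symmetric[of p' "p' + q'"] by (simp add: Suc binom_def nat_add_distrib)
  qed
  then show ?thesis
    unfolding pole_part_def binom_diag by (simp add: Suc)
qed

text \<open>The simple poles at \<open>N = 0\<close> and \<open>N = - a\<close> have opposite
  residues, by the symmetry of the binomial coefficient; grouping them as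
  \<open>1 / N - 1 / (N + a)\<close> makes every term summable over \<open>N\<close>.\<close>

lemma partial_fractions_binom:
  fixes N a :: "'a::field_char_0"
  assumes "N \<noteq> 0" "a \<noteq> 0" "N + a \<noteq> 0" "r + t \<ge> 2"
  shows "1 / (N ^ r * (N + a) ^ t) =
      (\<Sum>i<r - 1. (-1) ^ i / a ^ (t + i) * of_nat (binom (int i + int t - 1) (int i)) * (1 / N ^ (r - i)))
    - (-1) ^ r / a ^ (r + t - 1) * of_nat (binom (int r + int t - 2) (int t - 1)) * (1 / N - 1 / (N + a))
    + (-1) ^ r * (\<Sum>j<t - 1. of_nat (binom (int j + int r - 1) (int j)) / a ^ (j + r) * (1 / (N + a) ^ (t - j)))"
proof -
  have rearrange: "u - c * p + (v + c * q) = u - c * (p - q) + v" for u v c p q :: 'a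
    by (simp add: algebra_simps)
  have sgn: "(-1) ^ t * (c / ((- a) ^ (i + t) * y)) = (-1) ^ i / a ^ (t + i) * c * (1 / y)"
    for c y :: 'a and i
    by (subst power_minus) (simp add: power_add divide_simps mult_ac flip: power_mult_distrib)
  have sgn': "(-1) ^ t * (c / ((- a) ^ (r + t - 1) * N)) = - ((-1) ^ r / a ^ (r + t - 1) * c * (1 / N))"
    for c :: 'a
  proof -
    define k where "k = r + t - 1"
    have "r + t = Suc k" using assms by (simp add: k_def)
    then have "(-1) ^ (r + t) = - ((-1) ^ k :: 'a)" by simp
    then have key: "(-1) ^ t * (-1) ^ k = - ((-1) ^ r :: 'a)"
      by (auto simp: power_add minus_one_power_iff split: if_splits)
    have "c / ((- a) ^ k * N) = (-1) ^ k * (c / (a ^ k * N))"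
      by (cases "even k") simp_all
    then have "(-1) ^ t * (c / ((- a) ^ k * N)) = (-1) ^ t * (-1) ^ k * (c / (a ^ k * N))"
      by (simp only: mult.assoc)
    then have "(-1) ^ t * (c / ((- a) ^ k * N)) = - ((-1) ^ r / a ^ k * c * (1 / N))"
      unfolding key by simp
    then show ?thesis by (simp only: k_def)
  qed
  have sym: "binom (int t + int r - 2) (int r - 1) = binom (int r + int t - 2) (int t - 1)"
  proof (cases "r = 0 \<or> t = 0")
    case True
    then show ?thesis using assms(4) by (auto simp: binom_def binomial_eq_0)
  next
    case False
    then obtain r' t' where "r = Suc r'" "t = Suc t'" by (metis not0_implies_Suc)
    then show ?thesis
      using binomial_symmetric[of r' "r' + t'"] by (simp add: binom_def nat_add_distrib add.commute)
  qed
  have "1 / (N ^ r * (N + a) ^ t) =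
      (-1) ^ t * pole_part (- a) N r t + (-1) ^ r * pole_part a (N + a) t r"
    using partial_fractions[of N "N + a" r t] assms by force
  also have "(-1) ^ t * pole_part (- a) N r t =
      (\<Sum>i<r - 1. (-1) ^ i / a ^ (t + i) * of_nat (binom (int i + int t - 1) (int i)) * (1 / N ^ (r - i)))
    - (-1) ^ r / a ^ (r + t - 1) * of_nat (binom (int r + int t - 2) (int t - 1)) * (1 / N)"
    unfolding pole_part_split[OF assms(4)] distrib_left sum_distrib_left sgn sgn' by simp
  also have "(-1) ^ r * pole_part a (N + a) t r =
      (-1) ^ r * (\<Sum>j<t - 1. of_nat (binom (int j + int r - 1) (int j)) / a ^ (j + r) * (1 / (N + a) ^ (t - j)))
    + (-1) ^ r / a ^ (r + t - 1) * of_nat (binom (int r + int t - 2) (int t - 1)) * (1 / (N + a))"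
    using assms(4) by (subst pole_part_split) (simp_all add: distrib_left sym add.commute[of t r])
  finally show ?thesis by (rule trans[OF _ rearrange])
qed

subsection \<open>Digamma and polygamma sums\<close>

text \<open>Summands of gamma + psi(a + 1) for \<open>k = 0\<close> and, up to a constant factor, of
  the k-th derivative of psi at \<open>a + 1\<close> otherwise. As one family they share a single
  growth bound.\<close>

definition shift_term :: "nat \<Rightarrow> real \<Rightarrow> nat \<Rightarrow> complex" where
  "shift_term k a n = (if k = 0 then 1 / of_nat (Suc n) - 1 / (of_nat (Suc n) + of_real a)
     else 1 / (of_nat (Suc n) + of_real a) ^ Suc k)"

definition shift_sum :: "nat \<Rightarrow> real \<Rightarrow> complex" where
  "shift_sum k a = (\<Sum>n. shift_term k a n)"

text \<open>A bound that separates \<open>a\<close> from \<open>n\<close>. The exponent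
  \<open>e\<close> is what is spent on summability in \<open>n\<close>; it must be positive, and
  taking it small keeps the growth in \<open>a\<close> close to the power -k.\<close>

lemma norm_shift_term:
  assumes a: "a > 0" and e: "0 < e" "e \<le> 1"
  shows "norm (shift_term k a n) \<le> a powr (e - real k) * real (Suc n) powr (- 1 - e)"
proof -
  define N where "N = real (Suc n)"
  have N: "N > 0" by (simp add: N_def)
  show ?thesis
  proof (cases "k = 0")
    case True
    have "shift_term k a n = of_real (1 / N * (a / (N + a)))"
    proof -
      have "shift_term k a n = of_real (1 / N - 1 / (N + a))"
        by (simp add: True shift_term_def N_def)
      also have "1 / N - 1 / (N + a) = 1 / N * (a / (N + a))"
        using N a by (simp add: divide_simps) 
      finally show ?thesis .
    qed
    then have "norm (shift_term k a n) = 1 / N * (a / (N + a))"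
      using N a by (simp only: norm_of_real) simp
    \<comment> \<open>The quotient is at most 1 and at most \<open>a / N\<close>, hence at most any
      intermediate power of \<open>a / N\<close>.\<close>
    also have "a / (N + a) \<le> (a / N) powr e"
    proof (cases "a \<le> N")
      case True
      have "a / (N + a) \<le> a / N" using a N by (intro divide_left_mono) auto
      also have "\<dots> = (a / N) powr 1" using a N by simp
      also have "\<dots> \<le> (a / N) powr e" using True a N e by (intro powr_mono') auto
      finally show ?thesis .
    next
      case False
      have "a / (N + a) \<le> 1" using a N by simp
      also have "1 \<le> (a / N) powr e" using False a N e by (intro ge_one_powr_ge_zero) auto
      finally show ?thesis .
    qed
    then have "1 / N * (a / (N + a)) \<le> 1 / N * (a / N) powr e"
      using N by (intro mult_left_mono) auto
    also have "\<dots> = a powr e * N powr (- 1 - e)"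
      using a N by (simp add: powr_divide powr_diff powr_minus_divide)
    finally show ?thesis by (simp add: True N_def)
  next
    case False
    have "shift_term k a n = of_real (1 / (N + a) ^ Suc k)"
      using False by (simp add: shift_term_def N_def)
    then have "norm (shift_term k a n) = 1 / (N + a) ^ Suc k"
      using N a by (simp only: norm_of_real) simp
    \<comment> \<open>Both exponents are nonpositive because \<open>e\<close> is at most 1 and
      \<open>k\<close> at least 1, so \<open>N + a\<close> may be replaced by \<open>a\<close> in
      one factor and by \<open>N\<close> in the other.\<close>
    also have "\<dots> = (N + a) powr (e - real k) * (N + a) powr (- 1 - e)"
    proof -
      have "(N + a) powr - real (Suc k) = 1 / (N + a) ^ Suc k"
        using N a by (subst powr_minus_divide, subst powr_realpow) auto
      moreover have "e - real k + (- 1 - e) = - real (Suc k)" by simp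
      ultimately show ?thesis by (simp only: powr_add[symmetric])
    qed
    also have "\<dots> \<le> a powr (e - real k) * N powr (- 1 - e)"
      using False N a e by (intro mult_mono powr_mono2') auto
    finally show ?thesis by (simp add: N_def)
  qed
qed

lemma shift_term_sums:
  assumes "a > 0"
  shows "shift_term k a sums shift_sum k a"
proof -
  have "summable (\<lambda>n. a powr (1 - real k) * real (Suc n) powr (- 1 - 1))"
    by (intro summable_mult) (simp add: summable_Suc_powr_iff del: of_nat_Suc)
  then have "summable (shift_term k a)"
    by (rule summable_comparison_test') (rule norm_shift_term, use assms in auto)
  then show ?thesis unfolding shift_sum_def by (rule summable_sums)
qed

lemma norm_shift_sum:
  assumes e: "0 < e" "e \<le> 1"
  shows "\<exists>C\<ge>0. \<forall>a>0. norm (shift_sum k a) \<le> C * a powr (e - real k)"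
proof (intro exI[of _ "\<Sum>n. real (Suc n) powr (- 1 - e)"] conjI allI impI)
  have S: "summable (\<lambda>n. real (Suc n) powr (- 1 - e))"
    using e by (simp add: summable_Suc_powr_iff del: of_nat_Suc)
  then show "(\<Sum>n. real (Suc n) powr (- 1 - e)) \<ge> 0" by (rule suminf_nonneg) simp
  fix a :: real assume a: "a > 0"
  have "norm (shift_sum k a) \<le> (\<Sum>n. a powr (e - real k) * real (Suc n) powr (- 1 - e))"
    unfolding shift_sum_def
    by (intro norm_suminf_le norm_shift_term a e summable_mult S)
  also have "\<dots> = a powr (e - real k) * (\<Sum>n. real (Suc n) powr (- 1 - e))"
    by (rule suminf_mult[OF S])
  finally show "norm (shift_sum k a) \<le> (\<Sum>n. real (Suc n) powr (- 1 - e)) * a powr (e - real k)"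
    by (simp add: mult.commute)
qed

lemma shift_sum_summable:
  assumes x: "x > 0" and \<sigma>: "\<sigma> > 1 - real k"
  shows "summable (\<lambda>m. norm (shift_sum k (real (Suc m) * x)) * real (Suc m) powr (- \<sigma>))"
proof -
  \<comment> \<open>Half of the available margin gives the total exponent
    \<open>e - k - \<sigma>\<close> below -1; the cap at 1 is the range of the growth bound.\<close>
  define e where "e = min 1 ((\<sigma> + real k - 1) / 2)"
  have e: "0 < e" "e \<le> 1" "e - real k - \<sigma> < - 1"
    using \<sigma> by (auto simp: e_def min_def field_simps)
  obtain C where C: "C \<ge> 0" "\<And>a. a > 0 \<Longrightarrow> norm (shift_sum k a) \<le> C * a powr (e - real k)"
    using norm_shift_sum[OF e(1,2), of k] by blast
  have "summable (\<lambda>m. C * x powr (e - real k) * real (Suc m) powr (e - real k - \<sigma>))"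
    using e by (intro summable_mult) (simp add: summable_Suc_powr_iff del: of_nat_Suc)
  then show ?thesis
  proof (rule summable_comparison_test')
    fix m
    have "norm (shift_sum k (real (Suc m) * x)) * real (Suc m) powr (- \<sigma>)
        \<le> C * (real (Suc m) * x) powr (e - real k) * real (Suc m) powr (- \<sigma>)"
      using x by (intro mult_right_mono C) auto
    also have "\<dots> = C * x powr (e - real k) * (real (Suc m) powr (e - real k) * real (Suc m) powr (- \<sigma>))"
      using x by (simp add: powr_mult del: of_nat_Suc)
    also have "real (Suc m) powr (e - real k) * real (Suc m) powr (- \<sigma>) = real (Suc m) powr (e - real k - \<sigma>)"
      by (simp add: powr_add[symmetric] del: of_nat_Suc)
    finally show "norm (norm (shift_sum k (real (Suc m) * x)) * real (Suc m) powr (- \<sigma>))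
        \<le> C * x powr (e - real k) * real (Suc m) powr (e - real k - \<sigma>)"
      by simp
  qed
qed

lemma shift_sum_0: "shift_sum 0 a = euler_mascheroni + Digamma (of_real (a + 1))"
  by (simp add: shift_sum_def shift_term_def Digamma_def inverse_eq_divide add_ac)

lemma shift_sum_Polygamma:
  assumes "k > 0" "a > 0"
  shows "shift_sum k a = (-1) ^ Suc k / fact k * Polygamma k (of_real (a + 1))"
proof -
  have "complex_of_real (a + 1) \<noteq> 0"
    using assms(2) by (simp only: of_real_eq_0_iff)
  from Polygamma_LIMSEQ[OF this assms(1)] show ?thesis
    using assms(1) by (simp add: shift_sum_def shift_term_def sums_iff inverse_eq_divide add_ac del: power_Suc)
qed

definition shift_dirichlet :: "real \<Rightarrow> nat \<Rightarrow> complex \<Rightarrow> complex" where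
  "shift_dirichlet x k w = (\<Sum>m. shift_sum k (real (Suc m) * x) / of_nat (Suc m) powr w)"

lemma holomorphic_shift_dirichlet:
  assumes "x > 0"
  shows "shift_dirichlet x k holomorphic_on {w. Re w > 1 - real k}"
  unfolding shift_dirichlet_def
  by (intro holomorphic_on_dirichlet_series shift_sum_summable assms)

lemma shift_dirichlet_sums:
  assumes "x > 0" "Re w > 1 - real k"
  shows "(\<lambda>m. shift_sum k (real (Suc m) * x) / of_nat (Suc m) powr w) sums shift_dirichlet x k w"
proof -
  have "norm (shift_sum k (real (Suc m) * x) / of_nat (Suc m) powr w)
      = norm (shift_sum k (real (Suc m) * x)) * real (Suc m) powr (- Re w)" for m
    unfolding divide_inverse norm_mult norm_inverse norm_nat_powr powr_minus ..
  with shift_sum_summable[OF assms]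
  have "summable (\<lambda>m. norm (shift_sum k (real (Suc m) * x) / of_nat (Suc m) powr w))"
    by (simp only:)
  then show ?thesis
    unfolding shift_dirichlet_def by (rule summable_sums[OF summable_norm_cancel])
qed

subsection \<open>Reduction of the double series\<close>

text \<open>The right-hand side of the theorem before the polygamma functions are named: their signs
  and factorials are still inside \<open>shift_dirichlet\<close>.\<close>

definition theta_reduction :: "real \<Rightarrow> nat \<Rightarrow> nat \<Rightarrow> complex \<Rightarrow> complex" where
  "theta_reduction x r t s =
      (\<Sum>i<r - 1. (-1) ^ i / of_real x ^ (t + i) * of_nat (binom (int i + int t - 1) (int i))
           * riemann_zeta (s + of_nat t + of_nat i) * riemann_zeta (of_nat (r - i)))
    - (-1) ^ r / of_real x ^ (r + t - 1) * of_nat (binom (int r + int t - 2) (int t - 1))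
        * shift_dirichlet x 0 (of_nat r + s + of_nat t - 1)
    + (-1) ^ r * (\<Sum>j<t - 1. of_nat (binom (int j + int r - 1) (int j)) * (1 / of_real x ^ (j + r))
           * shift_dirichlet x (t - j - 1) (of_nat r + s + of_nat j))"

lemma holomorphic_theta_reduction:
  assumes x: "x > 0"
    and S: "\<And>s. s \<in> S \<Longrightarrow> Re s > 2 - real r - real t"
    and ne: "\<And>s i. s \<in> S \<Longrightarrow> i < r - 1 \<Longrightarrow> s + of_nat t + of_nat i \<noteq> 1"
  shows "theta_reduction x r t holomorphic_on S"
proof -
  have zeta: "(\<lambda>s. riemann_zeta (s + of_nat t + of_nat i)) holomorphic_on S" if "i < r - 1" for i
  proof -
    have "(riemann_zeta \<circ> (\<lambda>s. s + of_nat t + of_nat i)) holomorphic_on S"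
      using ne that
      by (intro holomorphic_on_compose_gen[OF _ holomorphic_riemann_zeta] holomorphic_intros) auto
    then show ?thesis by (simp add: o_def)
  qed
  \<comment> \<open>The condition on \<open>w\<close> says that \<open>s + w\<close> lies in the
    half plane of convergence of order \<open>k\<close> whenever Re s > 2 - r - t.\<close>
  have dir: "(\<lambda>s. shift_dirichlet x k (s + w)) holomorphic_on S"
    if "Re w \<ge> real r + real t - 1 - real k" for k w
  proof -
    have "(shift_dirichlet x k \<circ> (\<lambda>s. s + w)) holomorphic_on S"
      using S that
      by (intro holomorphic_on_compose_gen[OF _ holomorphic_shift_dirichlet[OF x]] holomorphic_intros)
         fastforce
    then show ?thesis by (simp add: o_def)
  qed
  have dir0: "(\<lambda>s. shift_dirichlet x 0 (of_nat r + s + of_nat t - 1)) holomorphic_on S"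
    using dir[where k = 0 and w = "of_nat r + of_nat t - 1"] by (simp add: algebra_simps)
  have dirj: "(\<lambda>s. shift_dirichlet x (t - j - 1) (of_nat r + s + of_nat j)) holomorphic_on S"
    if "j < t - 1" for j
  proof -
    have "real (t - j - 1) = real t - real j - 1" using that by linarith
    then show ?thesis
      using dir[where k = "t - j - 1" and w = "of_nat r + of_nat j"] by (simp add: algebra_simps)
  qed
  have "(\<lambda>s. theta_reduction x r t s) holomorphic_on S"
    unfolding theta_reduction_def by (intro holomorphic_intros zeta dir0 dirj) auto
  then show ?thesis .
qed

text \<open>As \<open>r + t\<close> is at least 2, the summand is at most n^(-2) m^(-Re s) in
  modulus. This product majorant permits summing over n first, after which each term is a Dirichlet
  series in m.\<close>

lemma theta_series_eq_reduction:
  assumes x: "x > 0" and rt: "r + t \<ge> 2" and s: "Re s > 1"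
  shows "theta_series (of_nat r) s (of_nat t) x = theta_reduction x r t s"
proof -
  define M :: "nat \<Rightarrow> complex" where "M = (\<lambda>m. of_nat (Suc m))"
  define a where "a = (\<lambda>m. real (Suc m) * x)"
  define F where "F = (\<lambda>n m. 1 / (M n powr of_nat r * M m powr s * of_real (real (Suc n) + a m) powr of_nat t))"
  have a: "a m > 0" for m using x by (simp add: a_def)
  have M: "M m \<noteq> 0" for m unfolding M_def by (simp del: of_nat_Suc)
  have Na: "M n + of_real (a m) \<noteq> 0" for n m
  proof -
    have "M n + of_real (a m) = of_real (real (Suc n) + a m)" by (simp add: M_def)
    moreover have "real (Suc n) + a m \<noteq> 0" using a[of m] by simp
    ultimately show ?thesis by (simp only: of_real_eq_0_iff not_False_eq_True)
  qed
  have F: "F n m = 1 / M m powr s * (1 / (M n ^ r * (M n + of_real (a m)) ^ t))" for n m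
  proof -
    have "of_real (real (Suc n) + a m) = M n + of_real (a m)" by (simp add: M_def)
    then show ?thesis
      unfolding F_def using M[of n] Na[of n m] by (simp only: powr_complexpow) (simp add: mult_ac)
  qed
  have "theta_series (of_nat r) s (of_nat t) x = (\<Sum>n. \<Sum>m. F n m)"
    unfolding theta_series_def F_def M_def a_def ..
  also have "\<dots> = (\<Sum>m. \<Sum>n. F n m)"
  proof (rule suminf_swap_dominated)
    show "summable (\<lambda>n. real (Suc n) powr (- 2))" "summable (\<lambda>m. real (Suc m) powr (- Re s))"
      using s by (simp_all add: summable_Suc_powr_iff del: of_nat_Suc)
    fix n m
    define N where "N = real (Suc n)"
    have N: "N \<ge> 1" by (simp add: N_def)
    have "N ^ 2 \<le> N ^ (r + t)" using N rt by (intro power_increasing)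
    also have "\<dots> = N ^ r * N ^ t" by (rule power_add)
    also have "\<dots> \<le> N ^ r * (N + a m) ^ t"
      using N a[of m] by (intro mult_left_mono power_mono) auto
    finally have "N ^ 2 \<le> N ^ r * (N + a m) ^ t" .
    moreover have "N ^ r * (N + a m) ^ t > 0"
      using N a[of m] by (intro mult_pos_pos zero_less_power) auto
    ultimately have "1 / (N ^ r * (N + a m) ^ t) \<le> 1 / N ^ 2"
      using N by (intro frac_le) auto
    also have "\<dots> = N powr (- 2)"
      using N powr_minus_divide[of N 2] powr_realpow[of N 2] by simp
    finally have *: "1 / (N ^ r * (N + a m) ^ t) \<le> N powr (- 2)" .
    have "norm (M n + of_real (a m)) = N + a m"
    proof -
      have "M n + of_real (a m) = of_real (N + a m)" by (simp add: M_def N_def)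
      then show ?thesis using N a[of m] by (simp only: norm_of_real)
    qed
    moreover have "norm (M n) = N" unfolding M_def N_def by (rule norm_of_nat)
    moreover have "norm (M m powr s) = real (Suc m) powr Re s" unfolding M_def by (rule norm_nat_powr)
    ultimately have "norm (F n m) = 1 / real (Suc m) powr Re s * (1 / (N ^ r * (N + a m) ^ t))"
      by (simp only: F norm_mult norm_divide norm_power norm_one)
    also have "\<dots> \<le> 1 / real (Suc m) powr Re s * N powr (- 2)"
      by (intro mult_left_mono *) simp
    finally show "norm (F n m) \<le> real (Suc n) powr (- 2) * real (Suc m) powr (- Re s)"
      by (simp add: N_def powr_minus_divide[of _ "Re s"] mult.commute)
  qed auto
  also have "\<dots> = theta_reduction x r t s"
  proof -
    let ?b1 = "\<lambda>i. of_nat (binom (int i + int t - 1) (int i)) :: complex"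
    let ?b2 = "of_nat (binom (int r + int t - 2) (int t - 1)) :: complex"
    let ?b3 = "\<lambda>j. of_nat (binom (int j + int r - 1) (int j)) :: complex"
    have zeta: "(\<lambda>n. 1 / M n ^ (r - i)) sums riemann_zeta (of_nat (r - i))" if "i < r - 1" for i
    proof -
      have "Re (of_nat (r - i)) > 1" using that by simp
      from zeta_sum_sums[OF this] show ?thesis
        using M by (simp add: riemann_zeta_eq_sum[OF \<open>Re (of_nat (r - i)) > 1\<close>] M_def del: of_nat_Suc of_nat_diff)
    qed
    have sh0: "(\<lambda>n. 1 / M n - 1 / (M n + of_real (a m))) sums shift_sum 0 (a m)" for m
      using shift_term_sums[OF a, of 0 m] by (simp add: shift_term_def[abs_def] M_def)
    have shj: "(\<lambda>n. 1 / (M n + of_real (a m)) ^ (t - j)) sums shift_sum (t - j - 1) (a m)"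
      if "j < t - 1" for m j
    proof -
      \<comment> \<open>Since \<open>j < t - 1\<close>, the order \<open>t - j - 1\<close> is the
        successor of this \<open>k\<close>, so the second branch of \<open>shift_term\<close>
        applies.\<close>
      define k where "k = t - j - 2"
      have k: "t - j = Suc (Suc k)" using that unfolding k_def by linarith
      then show ?thesis
        using shift_term_sums[OF a, of "Suc k" m] by (simp add: shift_term_def[abs_def] M_def)
    qed
    have inner: "(\<lambda>n. F n m) sums (1 / M m powr s *
        ((\<Sum>i<r - 1. (-1) ^ i / of_real (a m) ^ (t + i) * ?b1 i * riemann_zeta (of_nat (r - i)))
         - (-1) ^ r / of_real (a m) ^ (r + t - 1) * ?b2 * shift_sum 0 (a m)
         + (-1) ^ r * (\<Sum>j<t - 1. ?b3 j / of_real (a m) ^ (j + r) * shift_sum (t - j - 1) (a m))))" for m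
    proof -
      have "complex_of_real (a m) \<noteq> 0" using a[of m] by simp
      note pf = partial_fractions_binom[OF M this Na rt]
      show ?thesis
        unfolding F pf
        by (intro sums_mult sums_add sums_diff sums_sum zeta sh0 shj) auto
    qed
    \<comment> \<open>As \<open>a m\<close> is \<open>M m * x\<close>, its k-th power shifts the
      Dirichlet exponent from s to s + k and leaves a power of x outside.\<close>
    have scale: "1 / M m powr s * (c / of_real (a m) ^ k * d) = c / of_real x ^ k * (d / M m powr (s + of_nat k))"
      for c d k m
    proof -
      have "of_real (a m) = M m * of_real x" by (simp add: a_def M_def)
      then show ?thesis
        using M[of m] by (simp add: power_mult_distrib powr_add divide_simps mult_ac)
    qed
    have term1: "(\<lambda>m. 1 / M m powr s * ((-1) ^ i / of_real (a m) ^ (t + i) * ?b1 i * riemann_zeta (of_nat (r - i))))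
        sums ((-1) ^ i / of_real x ^ (t + i) * ?b1 i
           * riemann_zeta (s + of_nat t + of_nat i) * riemann_zeta (of_nat (r - i)))" for i
    proof -
      have re: "Re (s + of_nat (t + i)) > 1" using s by simp
      have zeta_eq: "riemann_zeta (s + of_nat t + of_nat i) = zeta_sum (s + of_nat (t + i))"
        using riemann_zeta_eq_sum[OF re] by (simp add: add.assoc)
      have sums: "(\<lambda>m. (-1) ^ i / of_real x ^ (t + i) * (?b1 i * riemann_zeta (of_nat (r - i))) * (1 / M m powr (s + of_nat (t + i))))
        sums ((-1) ^ i / of_real x ^ (t + i) * (?b1 i * riemann_zeta (of_nat (r - i))) * zeta_sum (s + of_nat (t + i)))"
        unfolding M_def by (intro sums_mult zeta_sum_sums re)
      have eq: "1 / M m powr s * ((-1) ^ i / of_real (a m) ^ (t + i) * ?b1 i * riemann_zeta (of_nat (r - i)))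
          = (-1) ^ i / of_real x ^ (t + i) * (?b1 i * riemann_zeta (of_nat (r - i))) * (1 / M m powr (s + of_nat (t + i)))" for m
        using scale[of m "(-1) ^ i" "t + i" "?b1 i * riemann_zeta (of_nat (r - i))"] by (simp add: mult_ac)
      show ?thesis
        unfolding eq zeta_eq using sums by (simp only: mult_ac)
    qed
    have term2: "(\<lambda>m. 1 / M m powr s * ((-1) ^ r / of_real (a m) ^ (r + t - 1) * ?b2 * shift_sum 0 (a m)))
        sums ((-1) ^ r / of_real x ^ (r + t - 1) * ?b2 * shift_dirichlet x 0 (of_nat r + s + of_nat t - 1))"
    proof -
      have w: "s + of_nat (r + t - 1) = of_nat r + s + of_nat t - 1"
        using rt by (simp add: of_nat_diff)
      have "Re (of_nat r + s + of_nat t - 1) > 1 - real 0" using s rt by simp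
      from sums_mult[OF shift_dirichlet_sums[OF x this], of "(-1) ^ r / of_real x ^ (r + t - 1) * ?b2"]
      show ?thesis
        unfolding mult.assoc scale w by (simp add: M_def a_def del: of_nat_Suc)
    qed
    have term3: "(\<lambda>m. 1 / M m powr s * (?b3 j / of_real (a m) ^ (j + r) * shift_sum (t - j - 1) (a m)))
        sums (?b3 j * (1 / of_real x ^ (j + r)) * shift_dirichlet x (t - j - 1) (of_nat r + s + of_nat j))"
      if "j < t - 1" for j
    proof -
      have w: "s + of_nat (j + r) = of_nat r + s + of_nat j" by simp
      have "Re (of_nat r + s + of_nat j) > 1 - real (t - j - 1)" using s by simp
      from sums_mult[OF shift_dirichlet_sums[OF x this], of "?b3 j / of_real x ^ (j + r)"]
      show ?thesis
        unfolding scale w by (simp add: M_def a_def del: of_nat_Suc)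
    qed
    have split: "1 / M m powr s *
        ((\<Sum>i<r - 1. (-1) ^ i / of_real (a m) ^ (t + i) * ?b1 i * riemann_zeta (of_nat (r - i)))
         - (-1) ^ r / of_real (a m) ^ (r + t - 1) * ?b2 * shift_sum 0 (a m)
         + (-1) ^ r * (\<Sum>j<t - 1. ?b3 j / of_real (a m) ^ (j + r) * shift_sum (t - j - 1) (a m)))
      = (\<Sum>i<r - 1. 1 / M m powr s * ((-1) ^ i / of_real (a m) ^ (t + i) * ?b1 i * riemann_zeta (of_nat (r - i))))
         - 1 / M m powr s * ((-1) ^ r / of_real (a m) ^ (r + t - 1) * ?b2 * shift_sum 0 (a m))
         + (-1) ^ r * (\<Sum>j<t - 1. 1 / M m powr s * (?b3 j / of_real (a m) ^ (j + r) * shift_sum (t - j - 1) (a m)))"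
      for m
      by (simp only: distrib_left right_diff_distrib sum_distrib_left
            mult.left_commute[of "1 / M m powr s" "(-1) ^ r"])
    have "(\<lambda>m. 1 / M m powr s *
        ((\<Sum>i<r - 1. (-1) ^ i / of_real (a m) ^ (t + i) * ?b1 i * riemann_zeta (of_nat (r - i)))
         - (-1) ^ r / of_real (a m) ^ (r + t - 1) * ?b2 * shift_sum 0 (a m)
         + (-1) ^ r * (\<Sum>j<t - 1. ?b3 j / of_real (a m) ^ (j + r) * shift_sum (t - j - 1) (a m))))
      sums theta_reduction x r t s"
      unfolding theta_reduction_def split
      by (intro sums_add sums_diff sums_sum sums_mult[of _ _ "(-1) ^ r"] term1 term2 term3) auto
    then show ?thesis
      using inner by (simp add: sums_iff)
  qed
  finally show ?thesis .
qed

section \<open>Analytic continuation in s for fixed r and t\<close>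

lemma theta_continuation_holomorphic:
  assumes \<Theta>: "is_theta_continuation x \<Theta>"
    and S: "open S" "\<And>s. s \<in> S \<Longrightarrow> (r, s, t) \<notin> theta_singular"
  shows "(\<lambda>s. \<Theta> r s t) holomorphic_on S"
  unfolding holomorphic_on_def field_differentiable_def
proof
  fix s assume s: "s \<in> S"
  let ?F = "\<lambda>(r, s, t). \<Theta> r s t"
  have "holomorphic3_on ?F (- theta_singular)"
    using \<Theta> by (simp add: is_theta_continuation_def meromorphic3_off_def)
  then obtain a b c where
    "(?F has_derivative (\<lambda>(u, v, w). a * u + b * v + c * w)) (at (r, s, t) within - theta_singular)"
    unfolding holomorphic3_on_def using S(2)[OF s] by blast
  then have F: "(?F has_derivative (\<lambda>(u, v, w). a * u + b * v + c * w))
      (at (r, s, t) within (\<lambda>s. (r, s, t)) ` S)"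
    by (rule has_derivative_subset) (use S in auto)
  \<comment> \<open>The chain rule along this complex line leaves only the middle coefficient
    \<open>b\<close> of the total derivative.\<close>
  have "((\<lambda>s. (r, s, t)) has_derivative (\<lambda>v. (0, v, 0))) (at s within S)"
    by (auto intro!: derivative_eq_intros)
  from has_derivative_in_compose[OF this F]
  have "((\<lambda>s. \<Theta> r s t) has_field_derivative b) (at s within S)"
    by (simp add: has_field_derivative_def)
  then show "\<exists>f'. ((\<lambda>s. \<Theta> r s t) has_field_derivative f') (at s within S)" ..
qed

lemma theta_continuation_eq_reduction:
  assumes x: "x > 0" and \<Theta>: "is_theta_continuation x \<Theta>" and rt: "r + t \<ge> 2"
    and s: "Re s > 2 - real r - real t" "(of_nat r, s, of_nat t) \<notin> theta_singular"
  shows "\<Theta> (of_nat r) s (of_nat t) = theta_reduction x r t s"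
proof -
  \<comment> \<open>A point s = 1 - l - t lies in the half plane exactly when
    \<open>l < r - 1\<close>, so these are the only singular points inside, and they are the poles
    of the zeta factors.\<close>
  define D where "D = {s. Re s > 2 - real r - real t} - (\<lambda>l. 1 - of_nat l - of_nat t) ` {..<r - 1}"
  have D: "(of_nat r, z, of_nat t) \<notin> theta_singular" if z: "z \<in> D" for z
  proof
    assume "(of_nat r, z, of_nat t) \<in> theta_singular"
    then consider l :: nat where "of_nat r + of_nat t = (1 :: complex) - of_nat l"
      | l :: nat where "z + of_nat t = 1 - of_nat l" | "of_nat r + z + of_nat t = 2"
      unfolding theta_singular_def by blast
    then show False
    proof cases
      case (1 l)
      from arg_cong[OF this, of Re] show False using rt by simp
    next
      case (2 l)
      then have zl: "z = 1 - of_nat l - of_nat t" by (simp add: algebra_simps)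
      with z have "2 - real r - real t < 1 - real l - real t" by (simp add: D_def)
      then have "l < r - 1" by linarith
      with zl z show False by (simp add: D_def)
    next
      case 3
      from arg_cong[OF this, of Re] z show False by (simp add: D_def)
    qed
  qed
  have "open D"
    unfolding D_def by (intro open_Diff open_Re_greater finite_imp_closed) auto
  have "connected D"
    unfolding D_def by (intro connected_open_diff_countable open_Re_greater connected_Re_greater) auto
  have sD: "s \<in> D"
    using s by (auto simp: D_def theta_singular_def)
  \<comment> \<open>The removed points have real part at most 1.\<close>
  have sub: "{s. Re s > 1} \<subseteq> D"
    using rt by (auto simp: D_def)
  show ?thesis
  proof (rule analytic_continuation_open[of "{s. Re s > 1}" D "\<lambda>s. \<Theta> (of_nat r) s (of_nat t)"])
    show "{s. Re s > 1} \<noteq> {}" by (auto intro!: exI[of _ 2])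
    show "(\<lambda>s. \<Theta> (of_nat r) s (of_nat t)) holomorphic_on D"
      by (rule theta_continuation_holomorphic[OF \<Theta> \<open>open D\<close> D])
    show "theta_reduction x r t holomorphic_on D"
    proof (rule holomorphic_theta_reduction[OF x])
      show "z + of_nat t + of_nat i \<noteq> 1" if "z \<in> D" "i < r - 1" for z i
      proof
        assume "z + of_nat t + of_nat i = 1"
        then have "z = 1 - of_nat i - of_nat t" by (simp add: algebra_simps)
        then show False using that by (simp add: D_def)
      qed
    qed (simp add: D_def)
    show "\<Theta> (of_nat r) z (of_nat t) = theta_reduction x r t z" if "z \<in> {s. Re s > 1}" for z
    proof -
      have "(of_nat r, z, of_nat t) \<in> theta_convergence"
        using that rt by (auto simp: theta_convergence_def)
      then have "\<Theta> (of_nat r) z (of_nat t) = theta_series (of_nat r) z (of_nat t) x"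
        using \<Theta> by (auto simp: is_theta_continuation_def)
      then show ?thesis using theta_series_eq_reduction[OF x rt] that by simp
    qed
  qed (use \<open>open D\<close> \<open>connected D\<close> sub sD open_Re_greater in auto)
qed

section \<open>Return to digamma and polygamma functions\<close>

lemma shift_dirichlet_0:
  "shift_dirichlet x 0 w =
    (\<Sum>m. (euler_mascheroni + Digamma (of_real (real (Suc m) * x + 1))) / of_nat (Suc m) powr w)"
  unfolding shift_dirichlet_def shift_sum_0 ..

lemma shift_dirichlet_Polygamma:
  assumes x: "x > 0" and k: "k > 0" and w: "Re w > 1 - real k"
  shows "shift_dirichlet x k w = (-1) ^ Suc k / fact k *
    (\<Sum>m. Polygamma k (of_real (real (Suc m) * x + 1)) / of_nat (Suc m) powr w)"
proof -
  define q :: complex where "q = (-1) ^ Suc k / fact k"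
  have q: "q \<noteq> 0" by (simp add: q_def)
  have pos: "real (Suc m) * x > 0" for m using x by simp
  \<comment> \<open>Dividing by the nonzero constant carries convergence over to the polygamma
    series itself.\<close>
  from sums_mult[OF shift_dirichlet_sums[OF x w], of "1 / q"]
  have "(\<lambda>m. Polygamma k (of_real (real (Suc m) * x + 1)) / of_nat (Suc m) powr w) sums
      (1 / q * shift_dirichlet x k w)"
    unfolding shift_sum_Polygamma[OF k pos] q_def[symmetric] using q by simp
  then have "shift_dirichlet x k w =
      q * (\<Sum>m. Polygamma k (of_real (real (Suc m) * x + 1)) / of_nat (Suc m) powr w)"
    using q by (simp add: sums_iff)
  then show ?thesis unfolding q_def .
qed

text \<open>For order k = t - j - 1 the constant (-1)^(k+1) / k! is the sign and factorial of the
  final formula, and the bound on Re s puts each exponent in the range of convergence.\<close>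

lemma theta_reduction_polygamma_sum:
  assumes x: "x > 0" and s: "Re s > 2 - real r - real t"
  shows "(\<Sum>j<t - 1. of_nat (binom (int j + int r - 1) (int j)) * (1 / of_real x ^ (j + r))
           * shift_dirichlet x (t - j - 1) (of_nat r + s + of_nat j)) =
      (\<Sum>j<t - 1. of_nat (binom (int j + int r - 1) (int j))
           * ((-1) ^ (t - j) / fact (t - j - 1)) * (1 / of_real x ^ (j + r))
           * (\<Sum>m. Polygamma (t - j - 1) (of_real (real (Suc m) * x + 1))
                   / of_nat (Suc m) powr (of_nat r + s + of_nat j)))"
proof (rule sum.cong[OF refl])
  fix j assume "j \<in> {..<t - 1}"
  then have j: "t - j - 1 > 0" "Suc (t - j - 1) = t - j" and "real (t - j - 1) = real t - real j - 1"
    by auto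
  then have w: "Re (of_nat r + s + of_nat j) > 1 - real (t - j - 1)" using s by simp
  show "of_nat (binom (int j + int r - 1) (int j)) * (1 / of_real x ^ (j + r))
           * shift_dirichlet x (t - j - 1) (of_nat r + s + of_nat j) =
      of_nat (binom (int j + int r - 1) (int j))
           * ((-1) ^ (t - j) / fact (t - j - 1)) * (1 / of_real x ^ (j + r))
           * (\<Sum>m. Polygamma (t - j - 1) (of_real (real (Suc m) * x + 1))
                   / of_nat (Suc m) powr (of_nat r + s + of_nat j))"
    unfolding shift_dirichlet_Polygamma[OF x j(1) w] j(2) by (simp only: mult_ac)
qed

lemma not_theta_singular_ge_2:
  assumes "r + t \<ge> 1" "(of_nat r, s, of_nat t) \<notin> theta_singular"
  shows "r + t \<ge> 2"
proof -
  have "of_nat (r + t) \<noteq> (1 :: complex) - of_nat 0"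
    using assms(2) unfolding theta_singular_def of_nat_add by blast
  then have "r + t \<noteq> 1" by (metis diff_zero of_nat_0 of_nat_1)
  then show ?thesis using assms(1) by linarith
qed

theorem theorem3p2:
  fixes x :: real and r t :: nat and s :: complex
    and \<Theta> :: "complex \<Rightarrow> complex \<Rightarrow> complex \<Rightarrow> complex"
  assumes "x > 0"
    and "is_theta_continuation x \<Theta>"
    and "r + t \<ge> 1"
    and "Re s > 2 - real r - real t"
    and "(of_nat r, s, of_nat t) \<notin> theta_singular"
  shows "\<Theta> (of_nat r) s (of_nat t) =
      (\<Sum>i<r - 1. (-1) ^ i / of_real x ^ (t + i) * of_nat (binom (int i + int t - 1) (int i))
           * riemann_zeta (s + of_nat t + of_nat i) * riemann_zeta (of_nat (r - i)))
    - (-1) ^ r / of_real x ^ (r + t - 1) * of_nat (binom (int r + int t - 2) (int t - 1))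
        * (\<Sum>m. (euler_mascheroni + Digamma (of_real (real (Suc m) * x + 1)))
                / of_nat (Suc m) powr (of_nat r + s + of_nat t - 1))
    + (-1) ^ r * (\<Sum>j<t - 1. of_nat (binom (int j + int r - 1) (int j))
           * ((-1) ^ (t - j) / fact (t - j - 1)) * (1 / of_real x ^ (j + r))
           * (\<Sum>m. Polygamma (t - j - 1) (of_real (real (Suc m) * x + 1))
                   / of_nat (Suc m) powr (of_nat r + s + of_nat j)))"
  using theta_continuation_eq_reduction[OF assms(1,2) not_theta_singular_ge_2[OF assms(3,5)] assms(4,5)]
  unfolding theta_reduction_def theta_reduction_polygamma_sum[OF assms(1,4)] shift_dirichlet_0 .

end
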